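(* Let $(M^{(n)})_{n=1}^\infty$ and $(\tilde M^{(n)})_{n=1}^\infty$ be two sequences of mappings $M^{(n)},\tilde M^{(n)}:\mathcal B_0(T^n)\to\mathscr L(\mathcal H)$, each satisfying condition (B) stated in the context (with constants $C_2(A)$ and $\tilde C_2(A)$, $A\in\mathcal B_0(T)$, respectively), and let $G$ and $\tilde G$ denote their generating functions. Assume that $$G(Z)=\tilde G(Z),\quad Z\in\operatorname{Dom}(G)\cap\operatorname{Dom}(\tilde G).$$ Then, for each $n\in\mathbb N$, $M^{(n)}=\tilde M^{(n)}$.
   Context: $T$ is a locally compact Polish space; $\mathcal B(\cdot)$ denotes Borel $\sigma$-algebras and $\mathcal B_0(T)$, $\mathcal B_0(T^n)$ the collections of relatively compact Borel sets. $\mathcal G$ and $\mathcal H$ are real separable Hilbert spaces; $\mathscr L(\cdot)$ denotes the bounded linear operators in the given space. **Condition (B)** for a sequence of mappings $M^{(n)}:\mathcal B_0(T^n)\to\mathscr L(\mathcal H)$, $n\in\mathbb N$: for any $F_1,F_2\in\mathcal H$ and any $A\in\mathcal B_0(T)$, the mapping $\mathcal B(A^n)\ni\Delta\mapsto M^{(n)}_{F_1,F_2}(\Delta):=(M^{(n)}(\Delta)F_1,F_2)_{\mathcal H}\in\mathbb R$ is a signed measure on $(A^n,\mathcal B(A^n))$ whose total variation on $A^n$ satisfies $|M^{(n)}_{F_1,F_2}|(A^n)\le C_2(A)^n\|F_1\|_{\mathcal H}\|F_2\|_{\mathcal H}$, where the constant $C_2(A)$ depends only on $A$ and is independent of $F_1,F_2\in\mathcal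 H$ and $n\in\mathbb N$. **Operator-valued test functions.** A mapping $Z:T\to\mathscr L(\mathcal G)$ is simple if $Z(t)=\sum_{i=1}^nZ_i\chi_{\Delta_i}(t)$ with $Z_i\in\mathscr L(\mathcal G)$, $\Delta_i\in\mathcal B_0(T)$, $n\in\mathbb N$, where $\chi_{\Delta_i}$ is the indicator function of $\Delta_i$. $\mathcal Z(T)$ is the set of all $Z:T\to\mathscr L(\mathcal G)$ for which there are a set $A\in\mathcal B_0(T)$ and a sequence of simple mappings $Z_n$ vanishing outside $A$ with $\sup_{t\in T}\|Z(t)-Z_n(t)\|_{\mathscr L(\mathcal G)}\to0$ as $n\to\infty$. Put $\|Z\|_\infty:=\sup_{t\in T}\|Z(t)\|_{\mathscr L(\mathcal G)}$, and let $\operatorname{supp}Z$ denote the support of $Z$. **Generating function.** For $Z\in\mathcal Z(T)$ and $n\in\mathbb N$ define the bounded four-linear form on $\mathcal G\times\mathcal H\times\mathcal G\times\mathcal H$ $$\int_{T^n}Z^{\circledast n}\otimes dM^{(n)}\,(G_1,F_1,G_2,F_2):=\int_{T^n}(Z(t_1)\cdots Z(t_n)G_1,G_2)_{\mathcal G}\,dM^{(n)}_{F_1,F_2}(t_1,\dots,t_n),$$ where $G_1,G_2\in\mathcal G$, $F_1,F_2\in\mathcal H$. Let $\operatorname{Dom}(G):=\{Z\in\mathcal Z(T):\|Z\|_\infty C_2(\operatorname{supp}Z)<1\}$, and for $Z\in\operatorname{Dom}(G)$ let $$G(Z):=\mathbf 1+\sum_{n=1}^\infty\int_{T^n}Z^{\circledast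 n}\otimes dM^{(n)},$$ a bounded four-linear form on $\mathcal G\times\mathcal H\times\mathcal G\times\mathcal H$, where $\mathbf 1$ denotes the form corresponding to the identity operator in $\mathcal G\otimes\mathcal H$, i.e. $(G_1,F_1,G_2,F_2)\mapsto(G_1,G_2)_{\mathcal G}(F_1,F_2)_{\mathcal H}$. $\tilde G$ and $\operatorname{Dom}(\tilde G)$ are defined in the same way from $(\tilde M^{(n)})_{n=1}^\infty$ and $\tilde C_2$.
   Formalization: The Hilbert space $\mathcal G$ is additionally assumed to be infinite-dimensional; for finite-dimensional $\mathcal G$ the claim fails (e.g. $\mathcal G=\mathbb R$, $T=\{a,b\}$, antisymmetric $M^{(2)}$). *)

theory Defs
  imports "HOL-Analysis.Analysis"
begin

section \<open>Relatively compact Borel sets of T and of its powers\<close>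

definition borel_of :: "'a topology \<Rightarrow> 'a measure" where
  "borel_of X = sigma (topspace X) {U. openin X U}"

definition rc_borel :: "'a topology \<Rightarrow> 'a set set" where
  "rc_borel X = {\<Delta> \<in> sets (borel_of X). compactin X (X closure_of \<Delta>)}"

text \<open>Points of the n-th power are the extensional functions on \<open>{..<n}\<close>; the coordinates
  are indexed from 0, so that the point written t_1, ..., t_n on paper is t 0, ..., t (n - 1).\<close>

definition power_topology :: "nat \<Rightarrow> (nat \<Rightarrow> 't::topological_space) topology" where
  "power_topology n = product_topology (\<lambda>_. euclidean) {..<n}"

definition set_power :: "'t set \<Rightarrow> nat \<Rightarrow> (nat \<Rightarrow> 't) set" where
  "set_power A n = PiE {..<n} (\<lambda>_. A)"

definition borel_power :: "'t::topological_space set \<Rightarrow> nat \<Rightarrow> (nat \<Rightarrow> 't) measure" where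
  "borel_power A n = borel_of (subtopology (power_topology n) (set_power A n))"

lemma rc_borel_euclidean:
  "rc_borel (euclidean :: 't::topological_space topology) = {\<Delta>. \<Delta> \<in> sets borel \<and> compact (closure \<Delta>)}"
  by (simp add: rc_borel_def borel_of_def borel_def flip: open_openin)

section \<open>Signed measures\<close>

text \<open>In this section a measure space N only provides a set and a sigma-algebra on it; its
  measure is ignored.\<close>

definition signed_measure_on :: "'a measure \<Rightarrow> ('a set \<Rightarrow> real) \<Rightarrow> bool" where
  "signed_measure_on N \<mu> \<longleftrightarrow> \<mu> {} = 0 \<and>
     (\<forall>E::nat \<Rightarrow> 'a set. range E \<subseteq> sets N \<longrightarrow> disjoint_family E \<longrightarrow>
        (\<lambda>i. \<mu> (E i)) sums \<mu> (\<Union>i. E i))"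

text \<open>The Jordan decomposition: for a signed measure, the positive part of E is the supremum of
  \<open>\<mu> B\<close> over measurable subsets B of E, the negative part is the supremum of \<open>- \<mu> B\<close>. The
  truncation of negative numbers by \<^const>\<open>ennreal\<close> is harmless because of B = {}.\<close>

definition jordan_pos :: "'a measure \<Rightarrow> ('a set \<Rightarrow> real) \<Rightarrow> 'a measure" where
  "jordan_pos N \<mu> =
     measure_of (space N) (sets N) (\<lambda>E. SUP B\<in>{B \<in> sets N. B \<subseteq> E}. ennreal (\<mu> B))"

definition jordan_neg :: "'a measure \<Rightarrow> ('a set \<Rightarrow> real) \<Rightarrow> 'a measure" where
  "jordan_neg N \<mu> = jordan_pos N (\<lambda>E. - \<mu> E)"

definition total_variation :: "'a measure \<Rightarrow> ('a set \<Rightarrow> real) \<Rightarrow> 'a set \<Rightarrow> ennreal" where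
  "total_variation N \<mu> E = emeasure (jordan_pos N \<mu>) E + emeasure (jordan_neg N \<mu>) E"

definition signed_integral :: "'a measure \<Rightarrow> ('a set \<Rightarrow> real) \<Rightarrow> ('a \<Rightarrow> real) \<Rightarrow> real" where
  "signed_integral N \<mu> f =
     integral\<^sup>L (jordan_pos N \<mu>) f - integral\<^sup>L (jordan_neg N \<mu>) f"

section \<open>Condition (B)\<close>

text \<open>Throughout, T is the type \<open>'t\<close>, the Hilbert spaces are the types \<open>'g\<close> and \<open>'h\<close>, and
  \<open>M n\<close> is only meaningful for n at least 1 and on \<open>rc_borel (power_topology n)\<close>.\<close>

definition matrix_element ::
    "(nat \<Rightarrow> (nat \<Rightarrow> 't) set \<Rightarrow> ('h::real_inner \<Rightarrow>\<^sub>L 'h)) \<Rightarrow> nat \<Rightarrow> 'h \<Rightarrow> 'h \<Rightarrow> (nat \<Rightarrow> 't) set \<Rightarrow> real" where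
  "matrix_element M n F1 F2 \<Delta> = inner (blinfun_apply (M n \<Delta>) F1) F2"

text \<open>The bound is an inequality in \<^typ>\<open>ennreal\<close>, where a negative right-hand side would be
  read as 0; hence the explicit \<open>0 \<le> C2 A\<close>, which for nonzero \<open>'h\<close> is implied by the bound
  (with n = 1) when this is read in the reals.\<close>

definition condition_B ::
    "(nat \<Rightarrow> (nat \<Rightarrow> 't::topological_space) set \<Rightarrow> ('h::real_inner \<Rightarrow>\<^sub>L 'h)) \<Rightarrow> ('t set \<Rightarrow> real) \<Rightarrow> bool" where
  "condition_B M C2 \<longleftrightarrow>
     (\<forall>A \<in> rc_borel euclidean. 0 \<le> C2 A \<and>
        (\<forall>n\<ge>1. \<forall>F1 F2.
           signed_measure_on (borel_power A n) (matrix_element M n F1 F2) \<and>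
           total_variation (borel_power A n) (matrix_element M n F1 F2) (set_power A n)
             \<le> ennreal (C2 A ^ n * norm F1 * norm F2)))"

section \<open>Operator-valued test functions\<close>

definition simple_map :: "('t::topological_space \<Rightarrow> ('g::real_normed_vector \<Rightarrow>\<^sub>L 'g)) \<Rightarrow> bool" where
  "simple_map Z \<longleftrightarrow>
     (\<exists>(n::nat) Y \<Delta>. (\<forall>i<n. \<Delta> i \<in> rc_borel euclidean) \<and>
        Z = (\<lambda>t. \<Sum>i<n. indicator (\<Delta> i) t *\<^sub>R Y i))"

definition test_maps :: "('t::topological_space \<Rightarrow> ('g::real_normed_vector \<Rightarrow>\<^sub>L 'g)) set" where
  "test_maps =
     {Z. \<exists>A \<in> rc_borel euclidean. \<exists>S :: nat \<Rightarrow> 't \<Rightarrow> ('g \<Rightarrow>\<^sub>L 'g).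
        (\<forall>k. simple_map (S k) \<and> (\<forall>t. t \<notin> A \<longrightarrow> S k t = 0)) \<and>
        uniform_limit UNIV S Z sequentially}"

definition sup_norm :: "('t \<Rightarrow> ('g::real_normed_vector \<Rightarrow>\<^sub>L 'g)) \<Rightarrow> real" where
  "sup_norm Z = (SUP t. norm (Z t))"

definition supp :: "('t::topological_space \<Rightarrow> ('g::real_normed_vector \<Rightarrow>\<^sub>L 'g)) \<Rightarrow> 't set" where
  "supp Z = closure {t. Z t \<noteq> 0}"

section \<open>The generating function\<close>

text \<open>The composition Z (t 0) o ... o Z (t (n - 1)), the last factor acting first.\<close>

definition op_product ::
    "('t \<Rightarrow> ('g::real_normed_vector \<Rightarrow>\<^sub>L 'g)) \<Rightarrow> nat \<Rightarrow> (nat \<Rightarrow> 't) \<Rightarrow> ('g \<Rightarrow>\<^sub>L 'g)" where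
  "op_product Z n t = foldr (\<lambda>i B. Z (t i) o\<^sub>L B) [0..<n] id_blinfun"

text \<open>\<open>matrix_element M n F1 F2\<close> is a signed measure only on powers of relatively compact Borel
  sets. The integral over the n-th power of T is therefore taken over the n-th power of
  \<open>supp Z\<close>, outside of which the integrand vanishes. (For \<open>Z \<in> test_maps\<close> the support
  is compact.)\<close>

definition tensor_integral ::
    "('t::topological_space \<Rightarrow> ('g::real_inner \<Rightarrow>\<^sub>L 'g)) \<Rightarrow>
     (nat \<Rightarrow> (nat \<Rightarrow> 't) set \<Rightarrow> ('h::real_inner \<Rightarrow>\<^sub>L 'h)) \<Rightarrow> nat \<Rightarrow>
     'g \<Rightarrow> 'h \<Rightarrow> 'g \<Rightarrow> 'h \<Rightarrow> real" where
  "tensor_integral Z M n G1 F1 G2 F2 =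
     signed_integral (borel_power (supp Z) n) (matrix_element M n F1 F2)
       (\<lambda>t. inner (blinfun_apply (op_product Z n t) G1) G2)"

definition gen_dom ::
    "('t set \<Rightarrow> real) \<Rightarrow> ('t::topological_space \<Rightarrow> ('g::real_normed_vector \<Rightarrow>\<^sub>L 'g)) set" where
  "gen_dom C2 = {Z \<in> test_maps. sup_norm Z * C2 (supp Z) < 1}"

text \<open>The series of four-linear forms, evaluated argumentwise. On \<open>gen_dom C2\<close> it converges
  absolutely, by comparison with a geometric series.\<close>

definition gen_fun ::
    "(nat \<Rightarrow> (nat \<Rightarrow> 't::topological_space) set \<Rightarrow> ('h::real_inner \<Rightarrow>\<^sub>L 'h)) \<Rightarrow>
     ('t \<Rightarrow> ('g::real_inner \<Rightarrow>\<^sub>L 'g)) \<Rightarrow> 'g \<Rightarrow> 'h \<Rightarrow> 'g \<Rightarrow> 'h \<Rightarrow> real" where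
  "gen_fun M Z = (\<lambda>G1 F1 G2 F2.
     inner G1 G2 * inner F1 F2 + (\<Sum>n. tensor_integral Z M (Suc n) G1 F1 G2 F2))"

end

theory Submission
  imports Defs
begin

text \<open>Evaluate the generating functions at the weighted shift
  \<open>Z(t) = \<Sum>i<n. \<epsilon> \<chi>\<^bsub>D i\<^esub>(t) |e i\<rangle>\<langle>e (i + 1)|\<close>
  for orthonormal vectors \<open>e 0, \<dots>, e n\<close>. Every product \<open>Z(t 0) \<dots> Z(t (k - 1))\<close> has vanishing matrix
  element between \<open>e n\<close> and \<open>e 0\<close> unless \<open>k = n\<close>, so that a single term
  \<open>\<epsilon>\<^sup>n (M\<^sup>n(D 0 \<times> \<dots> \<times> D (n - 1)) F1, F2)\<close> of the series survives. Hence the two sequences agree on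
  boxes, and by a Dynkin argument on all Borel subsets of a compact power.\<close>

section \<open>Jordan decomposition of signed measures\<close>

lemma signed_measure_on_uminus:
  "signed_measure_on N \<mu> \<Longrightarrow> signed_measure_on N (\<lambda>E. - \<mu> E)"
  unfolding signed_measure_on_def by (auto intro: sums_minus)

lemma signed_measure_on_Un:
  assumes \<mu>: "signed_measure_on N \<mu>" and AB: "A \<in> sets N" "B \<in> sets N" "A \<inter> B = {}"
  shows "\<mu> (A \<union> B) = \<mu> A + \<mu> B"
proof -
  have "disjoint_family (binaryset A B)"
    using AB(3) by (auto simp: disjoint_family_on_def binaryset_def)
  moreover have "range (binaryset A B) \<subseteq> sets N"
    using AB by (auto simp: range_binaryset_eq)
  ultimately have "(\<lambda>i. \<mu> (binaryset A B i)) sums \<mu> (\<Union>i. binaryset A B i)"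
    using \<mu> unfolding signed_measure_on_def by blast
  moreover have "(\<lambda>i. \<mu> (binaryset A B i)) sums (\<mu> A + \<mu> B)"
    using \<mu> by (intro binaryset_sums) (simp add: signed_measure_on_def)
  ultimately show ?thesis
    by (simp add: UN_binaryset_eq sums_unique2)
qed

lemma signed_measure_on_Diff:
  assumes "signed_measure_on N \<mu>" "A \<in> sets N" "B \<in> sets N" "B \<subseteq> A"
  shows "\<mu> (A - B) = \<mu> A - \<mu> B"
  using signed_measure_on_Un[OF assms(1) assms(3), of "A - B"] assms
  by (simp add: Un_absorb1)

lemma space_jordan_pos [simp]: "space (jordan_pos N \<mu>) = space N"
  by (simp add: jordan_pos_def)

lemma sets_jordan_pos [simp]: "sets (jordan_pos N \<mu>) = sets N"
  by (simp add: jordan_pos_def)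

text \<open>A competitor inside \<open>E\<close> and one inside \<open>F\<close> are disjoint, so
  their union competes for \<open>E \<union> F\<close>. Competitors of negative value are first
  replaced by the empty set: \<open>ennreal\<close> truncates them to 0, and it is additive only on
  nonnegative reals.\<close>

lemma positive_part_superadditive:
  assumes \<mu>: "signed_measure_on N \<mu>" and EF: "E \<inter> F = {}"
  shows "(SUP B\<in>{B \<in> sets N. B \<subseteq> E}. ennreal (\<mu> B)) + (SUP B\<in>{B \<in> sets N. B \<subseteq> F}. ennreal (\<mu> B))
     \<le> (SUP B\<in>{B \<in> sets N. B \<subseteq> E \<union> F}. ennreal (\<mu> B))" (is "?P E + ?P F \<le> _")
proof -
  have ne: "{B \<in> sets N. B \<subseteq> X} \<noteq> {}" for X by auto
  have \<mu>0: "\<mu> {} = 0" using \<mu> by (simp add: signed_measure_on_def)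
  have "ennreal (\<mu> B) + ennreal (\<mu> C) \<le> ?P (E \<union> F)"
    if B: "B \<in> sets N" "B \<subseteq> E" and C: "C \<in> sets N" "C \<subseteq> F" for B C
  proof -
    define B' where "B' = (if \<mu> B < 0 then {} else B)"
    define C' where "C' = (if \<mu> C < 0 then {} else C)"
    have *: "B' \<in> sets N" "B' \<subseteq> E" "C' \<in> sets N" "C' \<subseteq> F" "\<mu> B' \<ge> 0" "\<mu> C' \<ge> 0"
      using B C \<mu>0 by (auto simp: B'_def C'_def)
    have "ennreal (\<mu> B) + ennreal (\<mu> C) = ennreal (\<mu> B') + ennreal (\<mu> C')"
      using \<mu>0 by (auto simp: B'_def C'_def ennreal_neg)
    also have "\<dots> = ennreal (\<mu> (B' \<union> C'))"
    proof -
      have "B' \<inter> C' = {}"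
        using * EF by blast
      then show ?thesis
        using * signed_measure_on_Un[OF \<mu>, of B' C'] by (simp add: ennreal_plus)
    qed
    also have "\<dots> \<le> ?P (E \<union> F)"
      using * by (intro SUP_upper) auto
    finally show ?thesis .
  qed
  then show ?thesis
    unfolding ennreal_SUP_add_left[OF ne, symmetric]
    unfolding ennreal_SUP_add_right[OF ne]
    by (auto intro!: SUP_least)
qed

text \<open>\<open>measure_of\<close> returns the zero measure unless its set function is countably
  additive, so the supremum formula has to be earned. Cutting a competitor \<open>B\<close> along
  the sets \<open>A i\<close> gives countable subadditivity; finite superadditivity and monotonicity
  give the converse.\<close>

lemma emeasure_jordan_pos:
  assumes \<mu>: "signed_measure_on N \<mu>" and E: "E \<in> sets N"
  shows "emeasure (jordan_pos N \<mu>) E = (SUP B\<in>{B \<in> sets N. B \<subseteq> E}. ennreal (\<mu> B))"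
proof -
  define P where "P = (\<lambda>E. SUP B\<in>{B \<in> sets N. B \<subseteq> E}. ennreal (\<mu> B))"
  have \<mu>0: "\<mu> {} = 0" using \<mu> by (simp add: signed_measure_on_def)
  have P0: "P {} = 0"
  proof -
    have "{B \<in> sets N. B \<subseteq> {}} = {{}}" by auto
    then show ?thesis using \<mu>0 by (simp add: P_def)
  qed
  have "countably_additive (sets N) P"
  proof (rule countably_additiveI)
    fix A :: "nat \<Rightarrow> 'a set"
    assume A: "range A \<subseteq> sets N" "disjoint_family A" "(\<Union>i. A i) \<in> sets N"
    have "ennreal (\<mu> B) \<le> (\<Sum>i. P (A i))" if B: "B \<in> sets N" "B \<subseteq> (\<Union>i. A i)" for B
    proof -
      have "(\<lambda>i. \<mu> (B \<inter> A i)) sums \<mu> (\<Union>i. B \<inter> A i)"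
      proof -
        have "range (\<lambda>i. B \<inter> A i) \<subseteq> sets N" using A B by auto
        moreover have "disjoint_family (\<lambda>i. B \<inter> A i)"
          using A(2) by (auto simp: disjoint_family_on_def)
        ultimately show ?thesis using \<mu> unfolding signed_measure_on_def by blast
      qed
      moreover have "(\<Union>i. B \<inter> A i) = B" using B by auto
      ultimately have lim: "(\<lambda>n. ennreal (\<Sum>i<n. \<mu> (B \<inter> A i))) \<longlonglongrightarrow> ennreal (\<mu> B)"
        by (simp add: sums_def tendsto_ennrealI)
      have "ennreal (\<Sum>i<n. \<mu> (B \<inter> A i)) \<le> (\<Sum>i. P (A i))" for n
      proof -
        \<comment> \<open>Negative terms are raised to 0 before \<open>ennreal\<close> is moved into
          the sum, which needs nonnegative summands; termwise \<open>ennreal\<close> does not see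
          the change.\<close>
        have "ennreal (\<Sum>i<n. \<mu> (B \<inter> A i)) \<le> ennreal (\<Sum>i<n. max 0 (\<mu> (B \<inter> A i)))"
          by (intro ennreal_leI sum_mono) auto
        also have "\<dots> = (\<Sum>i<n. ennreal (max 0 (\<mu> (B \<inter> A i))))"
          by (rule sum_ennreal[symmetric]) simp
        also have "\<dots> = (\<Sum>i<n. ennreal (\<mu> (B \<inter> A i)))"
          by (intro sum.cong) (auto simp: max_def ennreal_neg)
        also have "\<dots> \<le> (\<Sum>i<n. P (A i))"
          unfolding P_def using A B by (intro sum_mono SUP_upper) auto
        also have "\<dots> \<le> (\<Sum>i. P (A i))"
          by (intro sum_le_suminf) auto
        finally show ?thesis .
      qed
      then show ?thesis
        using lim by (intro LIMSEQ_le_const2) auto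
    qed
    then have "P (\<Union>i. A i) \<le> (\<Sum>i. P (A i))"
      by (subst P_def) (auto intro: SUP_least)
    moreover have "(\<Sum>i. P (A i)) \<le> P (\<Union>i. A i)"
    proof (rule suminf_le_const)
      fix n
      have "(\<Sum>i<n. P (A i)) \<le> P (\<Union>i<n. A i)"
      proof (induction n)
        case (Suc n)
        have "(\<Union>i<n. A i) \<inter> A n = {}"
          using A(2) by (auto simp: disjoint_family_on_def) (metis IntI empty_iff less_irrefl)
        then have "P (\<Union>i<n. A i) + P (A n) \<le> P ((\<Union>i<n. A i) \<union> A n)"
          unfolding P_def by (rule positive_part_superadditive[OF \<mu>])
        with Suc have "(\<Sum>i<n. P (A i)) + P (A n) \<le> P ((\<Union>i<n. A i) \<union> A n)"
          by (meson add_right_mono order_trans)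
        then show ?case
          by (simp add: lessThan_Suc Un_commute add.commute)
      qed (simp add: P0)
      also have "\<dots> \<le> P (\<Union>i. A i)"
        unfolding P_def by (intro SUP_subset_mono) auto
      finally show "(\<Sum>i<n. P (A i)) \<le> P (\<Union>i. A i)" .
    qed simp
    ultimately show "(\<Sum>i. P (A i)) = P (\<Union>i. A i)" by (rule antisym[rotated])
  qed
  then have "emeasure (measure_of (space N) (sets N) P) E = P E"
    using P0 E by (intro emeasure_measure_of_sigma) (auto simp: positive_def sets.sigma_algebra_axioms)
  then show ?thesis
    by (simp add: jordan_pos_def P_def)
qed

text \<open>For \<open>B \<subseteq> E\<close>, the value at \<open>B\<close> is the value at
  \<open>E\<close> minus the value at \<open>E - B\<close>, hence at most the value at
  \<open>E\<close> plus the negative part of \<open>E\<close>. The supremum over \<open>B\<close>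
  gives one inequality, and the same argument for \<open>- \<mu>\<close> the other. Finite total
  variation allows the passage from \<open>ennreal\<close> to the reals.\<close>

lemma measure_jordan_diff:
  assumes \<mu>: "signed_measure_on N \<mu>" and fin: "total_variation N \<mu> (space N) < top"
    and E: "E \<in> sets N"
  shows "measure (jordan_pos N \<mu>) E - measure (jordan_neg N \<mu>) E = \<mu> E"
proof -
  note \<mu>' = signed_measure_on_uminus[OF \<mu>]
  have top: "emeasure (jordan_pos N \<mu>) E < top" "emeasure (jordan_neg N \<mu>) E < top"
    using fin emeasure_mono[of E "space N" "jordan_pos N \<mu>"]
      emeasure_mono[of E "space N" "jordan_neg N \<mu>"] sets.sets_into_space[OF E]
    by (auto simp: total_variation_def jordan_neg_def less_top[symmetric] top_unique)
  have le: "measure (jordan_pos N \<nu>) E \<le> \<nu> E + measure (jordan_pos N (\<lambda>E. - \<nu> E)) E"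
    if \<nu>: "signed_measure_on N \<nu>" and f: "emeasure (jordan_pos N \<nu>) E < top"
      "emeasure (jordan_pos N (\<lambda>E. - \<nu> E)) E < top" for \<nu>
  proof -
    let ?n = "measure (jordan_pos N (\<lambda>E. - \<nu> E)) E"
    have up: "- \<nu> B \<le> ?n" if "B \<in> sets N" "B \<subseteq> E" for B
    proof -
      have "ennreal (- \<nu> B) \<le> emeasure (jordan_pos N (\<lambda>E. - \<nu> E)) E"
        using that by (subst emeasure_jordan_pos[OF signed_measure_on_uminus[OF \<nu>] E])
          (auto intro!: SUP_upper)
      also have "\<dots> = ennreal ?n"
        using f by (intro emeasure_eq_ennreal_measure) auto
      finally show ?thesis
        by (simp add: ennreal_le_iff)
    qed
    have "\<nu> B \<le> \<nu> E + ?n" if "B \<in> sets N" "B \<subseteq> E" for B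
      using up[of "E - B"] signed_measure_on_Diff[OF \<nu> E, of B] that E by auto
    then have "emeasure (jordan_pos N \<nu>) E \<le> ennreal (\<nu> E + ?n)"
      by (subst emeasure_jordan_pos[OF \<nu> E]) (auto intro!: SUP_least ennreal_leI)
    \<comment> \<open>Needed since a negative right-hand side would have been truncated by
      \<open>ennreal\<close>.\<close>
    moreover have "0 \<le> \<nu> E + ?n"
      using up[OF E] by simp
    ultimately show ?thesis
      unfolding measure_def by (metis enn2real_leI)
  qed
  show ?thesis
    using le[OF \<mu>] le[OF \<mu>'] top by (simp add: jordan_neg_def)
qed

text \<open>Serves for the one surviving term of the series, whose integrand is a constant multiple
  of the indicator of a box.\<close>

lemma signed_integral_indicator:
  assumes "signed_measure_on N \<mu>" "total_variation N \<mu> (space N) < top" "E \<in> sets N"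
    and f: "\<And>x. x \<in> space N \<Longrightarrow> f x = c * indicator E x"
  shows "signed_integral N \<mu> f = c * \<mu> E"
proof -
  have "integral\<^sup>L (jordan_pos N \<nu>) f = c * measure (jordan_pos N \<nu>) E" for \<nu>
  proof -
    have "integral\<^sup>L (jordan_pos N \<nu>) f = integral\<^sup>L (jordan_pos N \<nu>) (\<lambda>x. c * indicator E x)"
      using f by (intro Bochner_Integration.integral_cong) auto
    then show ?thesis
      using sets.sets_into_space[OF assms(3)] by (simp add: Int_absorb2)
  qed
  then show ?thesis
    using measure_jordan_diff[OF assms(1-3)]
    by (simp add: signed_integral_def jordan_neg_def flip: right_diff_distrib)
qed

text \<open>The pi-lambda argument for signed measures. The condition \<open>space N \<in> G\<close>
  provides equal total masses, from which the complement step subtracts.\<close>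

lemma signed_measure_on_eqI:
  assumes \<mu>: "signed_measure_on N \<mu>" and \<nu>: "signed_measure_on N \<nu>"
    and G: "Int_stable G" "G \<subseteq> Pow (space N)" "space N \<in> G" "sets N = sigma_sets (space N) G"
    and eq: "\<And>E. E \<in> G \<Longrightarrow> \<mu> E = \<nu> E"
    and E: "E \<in> sets N"
  shows "\<mu> E = \<nu> E"
proof -
  have "E \<in> sigma_sets (space N) G" using E G by simp
  with G(1,2) show ?thesis
  proof (induction rule: sigma_sets_induct_disjoint)
    case (basic A)
    then show ?case by (rule eq)
  next
    case empty
    show ?case using \<mu> \<nu> by (simp add: signed_measure_on_def)
  next
    case (compl A)
    then have "A \<in> sets N" using G by simp
    then show ?case
      using compl eq[OF G(3)] sets.sets_into_space[of A N]
      by (simp add: signed_measure_on_Diff[OF \<mu>] signed_measure_on_Diff[OF \<nu>])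
  next
    case (union A)
    then have "range A \<subseteq> sets N" using G by simp
    then have "(\<lambda>i. \<mu> (A i)) sums \<mu> (\<Union>i. A i)" "(\<lambda>i. \<nu> (A i)) sums \<nu> (\<Union>i. A i)"
      using \<mu> \<nu> union(1) unfolding signed_measure_on_def by blast+
    then show ?case using union by (simp add: sums_unique2)
  qed
qed

section \<open>Borel sets of powers\<close>

lemma space_borel_of [simp]: "space (borel_of X) = topspace X"
  unfolding borel_of_def by (rule space_measure_of) (auto dest: openin_subset)

lemma sets_borel_of: "sets (borel_of X) = sigma_sets (topspace X) {U. openin X U}"
  unfolding borel_of_def by (rule sets_measure_of) (auto dest: openin_subset)

lemma measurable_borel_of:
  assumes "continuous_map X Y f"
  shows "f \<in> measurable (borel_of X) (borel_of Y)"
  unfolding borel_of_def[of Y]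
proof (rule measurable_measure_of)
  fix U assume "U \<in> {U. openin Y U}"
  then have "openin X {x \<in> topspace X. f x \<in> U}"
    using assms by (simp add: continuous_map_def)
  moreover have "f -` U \<inter> space (borel_of X) = {x \<in> topspace X. f x \<in> U}"
    by auto
  ultimately show "f -` U \<inter> space (borel_of X) \<in> sets (borel_of X)"
    by (simp add: sets_borel_of sigma_sets.Basic)
qed (use assms in \<open>auto simp: continuous_map_def dest: openin_subset\<close>)

lemma borel_of_euclidean: "borel_of euclidean = borel"
  by (simp add: borel_of_def borel_def flip: open_openin)

lemma topspace_power_topology: "topspace (power_topology n) = set_power UNIV n"
  by (simp add: power_topology_def set_power_def)

lemma space_borel_power [simp]: "space (borel_power A n) = set_power A n"
  by (auto simp: borel_power_def topspace_power_topology set_power_def)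

lemma box_in_borel_power:
  assumes D: "\<And>i. i < n \<Longrightarrow> D i \<in> sets borel \<and> D i \<subseteq> A"
  shows "PiE {..<n} D \<in> sets (borel_power A n)"
proof -
  have "{t \<in> space (borel_power A n). t i \<in> D i} \<in> sets (borel_power A n)" if "i < n" for i
  proof -
    have "(\<lambda>t. t i) \<in> measurable (borel_power A n) borel"
      unfolding borel_power_def power_topology_def borel_of_euclidean[symmetric]
      using that
      by (intro measurable_borel_of continuous_map_from_subtopology
        continuous_map_product_projection) auto
    from measurable_sets[OF this, of "D i"] show ?thesis
      using D that by (simp add: vimage_def Int_def conj_commute)
  qed
  then have "{t \<in> space (borel_power A n). \<forall>i\<in>{..<n}. t i \<in> D i} \<in> sets (borel_power A n)"
    by (intro sets.sets_Collect_finite_All) auto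
  also have "{t \<in> space (borel_power A n). \<forall>i\<in>{..<n}. t i \<in> D i} = PiE {..<n} D"
  proof (intro equalityI subsetI)
    fix t assume "t \<in> PiE {..<n} D"
    then show "t \<in> {t \<in> space (borel_power A n). \<forall>i\<in>{..<n}. t i \<in> D i}"
      using D by (simp add: set_power_def PiE_iff subset_iff)
  qed (simp add: set_power_def PiE_iff)
  finally show ?thesis .
qed

section \<open>Boxes as a generating pi-system of the Borel sets of a power\<close>

definition boxes :: "'t::topological_space set \<Rightarrow> nat \<Rightarrow> (nat \<Rightarrow> 't) set set" where
  "boxes A n = {PiE {..<n} D | D. \<forall>i<n. D i \<in> sets borel \<and> D i \<subseteq> A}"

lemma Int_stable_boxes: "Int_stable (boxes A n)"
proof (rule Int_stableI)
  fix E F assume "E \<in> boxes A n" "F \<in> boxes A n"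
  then obtain D D' where *: "E = PiE {..<n} D" "\<forall>i<n. D i \<in> sets borel \<and> D i \<subseteq> A"
    "F = PiE {..<n} D'" "\<forall>i<n. D' i \<in> sets borel \<and> D' i \<subseteq> A"
    unfolding boxes_def by blast
  then have "E \<inter> F = PiE {..<n} (\<lambda>i. D i \<inter> D' i)" by (simp add: PiE_Int)
  moreover have "\<forall>i<n. D i \<inter> D' i \<in> sets borel \<and> D i \<inter> D' i \<subseteq> A"
    using * by blast
  ultimately show "E \<inter> F \<in> boxes A n"
    unfolding boxes_def by blast
qed

lemma boxes_subset: "boxes A n \<subseteq> Pow (set_power A n)"
  by (auto simp: boxes_def set_power_def PiE_iff)

text \<open>The union is taken over all boxes inside \<open>U\<close> with sides in a countable
  basis; there are countably many of these because the number of coordinates is finite.\<close>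

lemma openin_power_topology_countable_boxes:
  fixes U :: "(nat \<Rightarrow> 't::second_countable_topology) set"
  assumes U: "openin (power_topology n) U"
  obtains \<B> where "countable \<B>" "\<And>b. b \<in> \<B> \<Longrightarrow> \<exists>D. b = PiE {..<n} D \<and> (\<forall>i<n. open (D i))" "U = \<Union>\<B>"
proof -
  obtain B :: "'t set set" where B: "countable B" "topological_basis B"
    using ex_countable_basis by blast
  define \<B> where "\<B> = {b \<in> PiE {..<n} ` PiE {..<n} (\<lambda>_. B). b \<subseteq> U}"
  have "countable \<B>"
    unfolding \<B>_def using B by (intro countable_Collect countable_image countable_PiE) auto
  moreover have "\<exists>D. b = PiE {..<n} D \<and> (\<forall>i<n. open (D i))" if b: "b \<in> \<B>" for b
  proof -
    obtain D where "D \<in> PiE {..<n} (\<lambda>_. B)" "b = PiE {..<n} D"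
      using b by (auto simp: \<B>_def)
    then show ?thesis
      using topological_basis_open[OF B(2)] by (auto simp: PiE_iff)
  qed
  moreover have "U = \<Union>\<B>"
  proof (intro equalityI subsetI)
    fix x assume x: "x \<in> U"
    obtain X where X: "\<forall>i\<in>{..<n}. open (X i)" "x \<in> PiE {..<n} X" "PiE {..<n} X \<subseteq> U"
      using U x unfolding power_topology_def openin_product_topology_alt by auto
    have "\<exists>V\<in>B. x i \<in> V \<and> V \<subseteq> X i" if "i < n" for i
    proof -
      have "open (X i)" "x i \<in> X i" using X that by (auto simp: PiE_iff)
      then show ?thesis using topological_basisE[OF B(2)] by metis
    qed
    then obtain V where V: "\<And>i. i < n \<Longrightarrow> V i \<in> B \<and> x i \<in> V i \<and> V i \<subseteq> X i"
      by metis
    \<comment> \<open>Restriction turns the chosen sides into a member of the countable set of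
      extensional functions that indexes the family.\<close>
    have "PiE {..<n} (restrict V {..<n}) \<subseteq> PiE {..<n} X"
      using V by (intro PiE_mono) auto
    then have "PiE {..<n} (restrict V {..<n}) \<subseteq> U"
      using X by simp
    moreover have "restrict V {..<n} \<in> PiE {..<n} (\<lambda>_. B)"
      using V by simp
    ultimately have "PiE {..<n} (restrict V {..<n}) \<in> \<B>"
      unfolding \<B>_def by auto
    moreover have "x \<in> PiE {..<n} (restrict V {..<n})"
      using V X by (auto simp: PiE_iff)
    ultimately show "x \<in> \<Union>\<B>" by blast
  qed (auto simp: \<B>_def)
  ultimately show ?thesis using that by blast
qed

text \<open>A relatively open set is the trace of an open one, hence a countable union of traces of
  open boxes. As \<open>A\<close> is Borel, each trace is again a box with Borel sides in
  \<open>A\<close>.\<close>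

lemma sets_borel_power:
  fixes A :: "'t::second_countable_topology set"
  assumes A: "A \<in> sets borel"
  shows "sets (borel_power A n) = sigma_sets (set_power A n) (boxes A n)"
proof
  show "sigma_sets (set_power A n) (boxes A n) \<subseteq> sets (borel_power A n)"
  proof -
    have "boxes A n \<subseteq> sets (borel_power A n)"
      by (auto simp: boxes_def intro: box_in_borel_power)
    from sets.sigma_sets_subset[OF this] show ?thesis by simp
  qed
  interpret sigma_algebra "set_power A n" "sigma_sets (set_power A n) (boxes A n)"
    by (rule sigma_algebra_sigma_sets) (rule boxes_subset)
  have top: "topspace (subtopology (power_topology n) (set_power A n)) = set_power A n"
    using space_borel_power[of A n] unfolding borel_power_def by simp
  have "W \<in> sigma_sets (set_power A n) (boxes A n)"
    if W: "openin (subtopology (power_topology n) (set_power A n)) W" for W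
  proof -
    obtain U where U: "openin (power_topology n) U" "W = U \<inter> set_power A n"
      using W by (auto simp: openin_subtopology)
    obtain \<B> where \<B>: "countable \<B>" "U = \<Union>\<B>"
      "\<And>b. b \<in> \<B> \<Longrightarrow> \<exists>D. b = PiE {..<n} D \<and> (\<forall>i<n. open (D i))"
      using openin_power_topology_countable_boxes[OF U(1)] by metis
    have "b \<inter> set_power A n \<in> sigma_sets (set_power A n) (boxes A n)" if b: "b \<in> \<B>" for b
    proof -
      obtain D where D: "b = PiE {..<n} D" "\<forall>i<n. open (D i)" using \<B>(3) b by blast
      then have "b \<inter> set_power A n = PiE {..<n} (\<lambda>i. D i \<inter> A)"
        by (simp add: set_power_def PiE_Int)
      moreover have "\<forall>i<n. D i \<inter> A \<in> sets borel \<and> D i \<inter> A \<subseteq> A"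
        using D A by auto
      ultimately show ?thesis
        unfolding boxes_def by (intro sigma_sets.Basic) blast
    qed
    then have "(\<Union>b\<in>\<B>. b \<inter> set_power A n) \<in> sigma_sets (set_power A n) (boxes A n)"
      using \<B>(1) by (intro countable_UN') auto
    then show ?thesis using U \<B> by (simp add: Int_commute UN_extend_simps)
  qed
  then show "sets (borel_power A n) \<subseteq> sigma_sets (set_power A n) (boxes A n)"
    unfolding borel_power_def sets_borel_of top by (intro sigma_sets_mono) auto
qed

text \<open>Condition (B) speaks only about powers of relatively compact sets, so
  \<open>\<Delta>\<close> has to be placed inside one. The union of the coordinate projections of
  its compact closure serves as the base.\<close>

lemma rc_borel_power_in_compact_power:
  fixes \<Delta> :: "(nat \<Rightarrow> 't::t2_space) set"
  assumes \<Delta>: "\<Delta> \<in> rc_borel (power_topology n)"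
  obtains A where "compact A" "\<Delta> \<in> sets (borel_power A n)"
proof -
  let ?X = "power_topology n :: (nat \<Rightarrow> 't) topology"
  define K where "K = ?X closure_of \<Delta>"
  have \<Delta>b: "\<Delta> \<in> sets (borel_of ?X)" and K: "compactin ?X K"
    using \<Delta> by (auto simp: rc_borel_def K_def)
  have top: "\<Delta> \<subseteq> topspace ?X" using sets.sets_into_space[OF \<Delta>b] by simp
  define A where "A = (\<Union>i<n. (\<lambda>t. t i) ` K)"
  have "compactin euclidean ((\<lambda>t. t i) ` K)" if "i < n" for i
    using that by (intro image_compactin[OF K])
      (auto simp: power_topology_def intro!: continuous_map_product_projection)
  then have "compact A" unfolding A_def by (intro compact_UN) auto
  moreover have "\<Delta> \<subseteq> set_power A n"
  proof
    fix t assume t: "t \<in> \<Delta>"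
    then have "t \<in> K" using closure_of_subset[OF top] by (auto simp: K_def)
    then show "t \<in> set_power A n"
      using t top by (auto simp: set_power_def topspace_power_topology PiE_iff A_def)
  qed
  \<comment> \<open>The inclusion of the subspace is continuous, so the trace of
    \<open>\<Delta>\<close> is Borel there; by the inclusion just shown the trace is
    \<open>\<Delta>\<close> itself.\<close>
  moreover have "(\<lambda>t. t) -` \<Delta> \<inter> space (borel_power A n) \<in> sets (borel_power A n)"
    unfolding borel_power_def
    by (rule measurable_sets[OF measurable_borel_of \<Delta>b])
      (intro continuous_map_from_subtopology continuous_map_id[unfolded id_def])
  ultimately show ?thesis
    using that[of A] by (simp add: Int_absorb2)
qed

section \<open>Weighted shifts\<close>

text \<open>Gram-Schmidt: a finite span is proper, so some vector has a nonzero residual after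
  projection, and the normalised residual extends the system. A shift of length \<open>n\<close>
  uses \<open>n + 1\<close> orthonormal vectors with \<open>n\<close> arbitrary; this is where
  infinite dimension enters.\<close>

lemma orthonormal_system_exists:
  assumes "\<not> (\<exists>B :: 'g::real_inner set. finite B \<and> span B = UNIV)"
  obtains e :: "nat \<Rightarrow> 'g::real_inner" where "\<And>i j. i < n \<Longrightarrow> j < n \<Longrightarrow> inner (e i) (e j) = of_bool (i = j)"
proof -
  have "\<exists>e :: nat \<Rightarrow> 'g. \<forall>i<n. \<forall>j<n. inner (e i) (e j) = of_bool (i = j)"
  proof (induction n)
    case (Suc n)
    then obtain e :: "nat \<Rightarrow> 'g" where e: "\<forall>i<n. \<forall>j<n. inner (e i) (e j) = of_bool (i = j)"
      by blast
    have "span (e ` {..<n}) \<noteq> UNIV" using assms by blast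
    then obtain x where x: "x \<notin> span (e ` {..<n})" by blast
    define y where "y = x - (\<Sum>i<n. inner (e i) x *\<^sub>R e i)"
    have "(\<Sum>i<n. inner (e i) x *\<^sub>R e i) \<in> span (e ` {..<n})"
      by (intro span_sum span_scale span_base) auto
    with x have "y \<noteq> 0" by (auto simp: y_def)
    have "inner (e j) y = 0" if "j < n" for j
    proof -
      have "(\<Sum>i<n. inner (e i) x * inner (e j) (e i)) = (\<Sum>i<n. if i = j then inner (e j) x else 0)"
        using e that by (intro sum.cong) auto
      then show ?thesis
        using that by (simp add: y_def inner_diff_right inner_sum_right)
    qed
    then have "\<forall>i<Suc n. \<forall>j<Suc n. inner ((e(n := sgn y)) i) ((e(n := sgn y)) j) = of_bool (i = j)"
      using e \<open>y \<noteq> 0\<close>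
      by (auto simp: less_Suc_eq sgn_div_norm inner_commute[of y] power2_norm_eq_inner[symmetric]
          power2_eq_square field_simps)
    then show ?case by blast
  qed simp
  then show ?thesis using that by blast
qed

section \<open>Rank-one operators and the generating function at a weighted shift\<close>

definition rank_one :: "'g::real_inner \<Rightarrow> 'g \<Rightarrow> 'g \<Rightarrow>\<^sub>L 'g" where
  "rank_one u v = blinfun_scaleR_left u o\<^sub>L blinfun_inner_left v"

lemma rank_one_apply [simp]: "blinfun_apply (rank_one u v) w = inner w v *\<^sub>R u"
  by (simp add: rank_one_def)

lemma norm_rank_one_le: "norm (rank_one u v) \<le> norm u * norm v"
proof (rule norm_blinfun_bound)
  fix w
  have "\<bar>inner w v\<bar> * norm u \<le> (norm w * norm v) * norm u"
    by (intro mult_right_mono Cauchy_Schwarz_ineq2) auto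
  then show "norm (rank_one u v w) \<le> norm u * norm v * norm w"
    by (simp add: mult_ac)
qed simp

text \<open>The sets \<open>D i\<close> may overlap or coincide: which of them is tested at a given
  factor is decided by the basis vector on which that factor acts, not by disjointness.\<close>

definition shift_map ::
    "real \<Rightarrow> (nat \<Rightarrow> 'g::real_inner) \<Rightarrow> (nat \<Rightarrow> 't set) \<Rightarrow> nat \<Rightarrow> 't \<Rightarrow> 'g \<Rightarrow>\<^sub>L 'g" where
  "shift_map \<epsilon> e D n t = (\<Sum>i<n. indicator (D i) t *\<^sub>R (\<epsilon> *\<^sub>R rank_one (e i) (e (Suc i))))"

text \<open>\<open>foldr\<close> exposes the outermost factor, whereas following a vector through
  the product requires the innermost one, which acts first.\<close>

lemma op_product_Suc: "op_product Z (Suc k) t = op_product Z k t o\<^sub>L Z (t k)"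
proof -
  have *: "foldr (\<lambda>i B. Z (t i) o\<^sub>L B) xs C = foldr (\<lambda>i B. Z (t i) o\<^sub>L B) xs id_blinfun o\<^sub>L C" for xs C
    by (induction xs) (auto intro: blinfun_eqI)
  show ?thesis
    unfolding op_product_def by (simp, subst *) (auto intro: blinfun_eqI)
qed

context
  fixes \<epsilon> :: real and e :: "nat \<Rightarrow> 'g::real_inner" and D :: "nat \<Rightarrow> 't::topological_space set"
    and n :: nat
  assumes e: "\<And>i j. i < Suc n \<Longrightarrow> j < Suc n \<Longrightarrow> inner (e i) (e j) = of_bool (i = j)"
    and \<epsilon>: "\<epsilon> > 0"
begin

lemma shift_map_0: "shift_map \<epsilon> e D n t (e 0) = 0"
  unfolding shift_map_def blinfun.sum_left
  by (intro sum.neutral) (auto simp: blinfun.scaleR_left e)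

lemma shift_map_Suc:
  assumes "m < n"
  shows "shift_map \<epsilon> e D n t (e (Suc m)) = (\<epsilon> * indicator (D m) t) *\<^sub>R e m"
proof -
  have "shift_map \<epsilon> e D n t (e (Suc m)) =
      (\<Sum>i<n. if i = m then (\<epsilon> * indicator (D m) t) *\<^sub>R e m else 0)"
    unfolding shift_map_def blinfun.sum_left
    using assms by (intro sum.cong) (auto simp: blinfun.scaleR_left e)
  then show ?thesis using assms by simp
qed

text \<open>Each factor lowers the index of the basis vector by one and contributes \<epsilon> and
  one indicator. With fewer than \<open>m\<close> factors the result is still orthogonal to
  \<open>e 0\<close>; with more, \<open>e 0\<close> has been annihilated. The induction peels off
  the innermost factor, hence \<open>m\<close> varies.\<close>

lemma inner_op_product_shift_map:
  assumes "m \<le> n"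
  shows "inner (op_product (shift_map \<epsilon> e D n) k t (e m)) (e 0)
    = (if k = m then \<epsilon> ^ m * (\<Prod>i<m. indicator (D i) (t i)) else 0)"
  using assms
proof (induction k arbitrary: m)
  case 0
  then show ?case by (simp add: op_product_def e)
next
  case (Suc k)
  then show ?case
    by (cases m) (auto simp: op_product_Suc shift_map_0 shift_map_Suc blinfun.scaleR_right)
qed

text \<open>Overlapping sets cause no cancellation: for \<open>t \<in> D i\<close> the vector
  \<open>e (Suc i)\<close> is sent to a nonzero multiple of \<open>e i\<close>.\<close>

lemma shift_map_eq_0_iff: "shift_map \<epsilon> e D n t = 0 \<longleftrightarrow> (\<forall>i<n. t \<notin> D i)"
proof
  assume 0: "shift_map \<epsilon> e D n t = 0"
  show "\<forall>i<n. t \<notin> D i"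
  proof (intro allI impI notI)
    fix i assume "i < n" "t \<in> D i"
    then have "\<epsilon> *\<^sub>R e i = 0"
      using shift_map_Suc[of i t] 0 by simp
    then show False
      using e[of i i] \<epsilon> \<open>i < n\<close> by simp
  qed
qed (simp add: shift_map_def)

text \<open>The exact support matters, because both \<open>gen_dom\<close> and the domain of
  integration are expressed through it.\<close>

lemma supp_shift_map: "supp (shift_map \<epsilon> e D n) = closure (\<Union>i<n. D i)"
proof -
  have "{t. shift_map \<epsilon> e D n t \<noteq> 0} = (\<Union>i<n. D i)"
    by (auto simp: shift_map_eq_0_iff)
  then show ?thesis by (simp add: supp_def)
qed

lemma norm_shift_map_le: "norm (shift_map \<epsilon> e D n t) \<le> real n * \<epsilon>"
proof -
  have "norm (indicator (D i) t *\<^sub>R (\<epsilon> *\<^sub>R rank_one (e i) (e (Suc i)))) \<le> \<epsilon>" if "i < n" for i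
  proof -
    have "norm (e i) = 1" "norm (e (Suc i)) = 1"
      using e that by (auto simp: norm_eq_1)
    then have "norm (rank_one (e i) (e (Suc i))) \<le> 1"
      using norm_rank_one_le[of "e i" "e (Suc i)"] by simp
    then show ?thesis
      using \<epsilon> by (auto simp: indicator_def)
  qed
  then show ?thesis
    unfolding shift_map_def
    using sum_norm_bound[of "{..<n}" "\<lambda>i. indicator (D i) t *\<^sub>R (\<epsilon> *\<^sub>R rank_one (e i) (e (Suc i)))" \<epsilon>]
    by simp
qed

lemma sup_norm_shift_map_le: "sup_norm (shift_map \<epsilon> e D n) \<le> real n * \<epsilon>"
  unfolding sup_norm_def by (intro cSUP_least norm_shift_map_le) auto

lemma shift_map_in_test_maps:
  assumes D: "\<And>i. i < n \<Longrightarrow> D i \<in> rc_borel euclidean"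
    and c: "compact (closure (\<Union>i<n. D i))"
  shows "shift_map \<epsilon> e D n \<in> test_maps"
proof -
  have "simple_map (shift_map \<epsilon> e D n)"
    unfolding simple_map_def shift_map_def[abs_def]
    using D by (intro exI[of _ n] exI[of _ D] exI[of _ "\<lambda>i. \<epsilon> *\<^sub>R rank_one (e i) (e (Suc i))"]) auto
  moreover have "closure (\<Union>i<n. D i) \<in> rc_borel euclidean"
    using c by (simp add: rc_borel_euclidean)
  moreover have "shift_map \<epsilon> e D n t = 0" if "t \<notin> closure (\<Union>i<n. D i)" for t
    using that closure_subset[of "\<Union>i<n. D i"] by (auto simp: shift_map_eq_0_iff)
  ultimately show ?thesis
    \<comment> \<open>The map is already simple, so the constant sequence approximates it.\<close>
    unfolding test_maps_def
    by (auto intro!: bexI[of _ "closure (\<Union>i<n. D i)"] exI[of _ "\<lambda>_. shift_map \<epsilon> e D n"]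
        uniform_limit_const)
qed

text \<open>Isolates the degree \<open>n\<close> coefficient: the shift moves \<open>e n\<close> to
  \<open>e 0\<close> in exactly \<open>n\<close> steps, so every other degree contributes 0.\<close>

lemma gen_fun_shift_map:
  fixes M :: "nat \<Rightarrow> (nat \<Rightarrow> 't) set \<Rightarrow> ('h::real_inner \<Rightarrow>\<^sub>L 'h)"
  assumes M: "condition_B M C2" and n: "n \<ge> 1"
    and D: "\<And>i. i < n \<Longrightarrow> D i \<in> sets borel"
    and c: "compact (closure (\<Union>i<n. D i))"
  shows "gen_fun M (shift_map \<epsilon> e D n) (e n) F1 (e 0) F2
    = \<epsilon> ^ n * matrix_element M n F1 F2 (PiE {..<n} D)"
proof -
  let ?Z = "shift_map \<epsilon> e D n" and ?S = "closure (\<Union>i<n. D i)"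
  have S: "?S \<in> rc_borel euclidean"
    using c by (simp add: rc_borel_euclidean)
  \<comment> \<open>Here the integrand is identically zero.\<close>
  have "tensor_integral ?Z M k (e n) F1 (e 0) F2 = 0" if "k \<noteq> n" for k
    using that by (simp add: tensor_integral_def signed_integral_def inner_op_product_shift_map)
  \<comment> \<open>The series is indexed from 0 with terms of degree \<open>Suc k\<close>, so
    degree \<open>n\<close> sits at \<open>n - 1\<close>.\<close>
  then have "(\<Sum>k. tensor_integral ?Z M (Suc k) (e n) F1 (e 0) F2)
    = (\<Sum>k\<in>{n - 1}. tensor_integral ?Z M (Suc k) (e n) F1 (e 0) F2)"
    using n by (intro suminf_finite) auto
  also have "\<dots> = tensor_integral ?Z M n (e n) F1 (e 0) F2"
    using n by simp
  also have "\<dots> = \<epsilon> ^ n * matrix_element M n F1 F2 (PiE {..<n} D)"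
    unfolding tensor_integral_def supp_shift_map
  proof (rule signed_integral_indicator)
    show "signed_measure_on (borel_power ?S n) (matrix_element M n F1 F2)"
      using M S n by (auto simp: condition_B_def)
    have "total_variation (borel_power ?S n) (matrix_element M n F1 F2) (set_power ?S n)
        \<le> ennreal (C2 ?S ^ n * norm F1 * norm F2)"
      using M S n by (auto simp: condition_B_def)
    then show "total_variation (borel_power ?S n) (matrix_element M n F1 F2)
        (space (borel_power ?S n)) < top"
      by (simp add: le_less_trans)
    show "PiE {..<n} D \<in> sets (borel_power ?S n)"
      using D closure_subset[of "\<Union>i<n. D i"] by (intro box_in_borel_power) auto
    fix t assume "t \<in> space (borel_power ?S n)"
    \<comment> \<open>Membership in the box also demands extensionality, which the product of
      coordinate indicators does not detect.\<close>
    then have "t \<in> extensional {..<n}"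
      by (simp add: set_power_def PiE_iff)
    then have "(\<Prod>i<n. indicator (D i) (t i)) = (indicator (PiE {..<n} D) t :: real)"
      by (auto simp: indicator_def PiE_iff)
    then show "inner (op_product ?Z n t (e n)) (e 0) = \<epsilon> ^ n * indicator (PiE {..<n} D) t"
      by (simp add: inner_op_product_shift_map)
  qed
  \<comment> \<open>The identity term vanishes since \<open>e n\<close> and \<open>e 0\<close> are
    orthogonal for \<open>n \<ge> 1\<close>.\<close>
  finally show ?thesis
    using n by (simp add: gen_fun_def e)
qed

end

section \<open>Uniqueness: from boxes to all relatively compact Borel sets\<close>

theorem proposition2p2:
  fixes M M' :: "nat \<Rightarrow> (nat \<Rightarrow> 't::polish_space) set \<Rightarrow>
                   ('h::{real_inner, polish_space} \<Rightarrow>\<^sub>L 'h)"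
    and C2 C2' :: "'t set \<Rightarrow> real"
  assumes "locally_compact_space (euclidean :: 't topology)"
    and inf_dim: "\<not> (\<exists>B :: 'g::{real_inner, polish_space} set. finite B \<and> span B = UNIV)"
    and "condition_B M C2"
    and "condition_B M' C2'"
    and "\<And>Z :: 't \<Rightarrow> ('g \<Rightarrow>\<^sub>L 'g). Z \<in> gen_dom C2 \<inter> gen_dom C2' \<Longrightarrow> gen_fun M Z = gen_fun M' Z"
  shows "\<forall>n\<ge>1. \<forall>\<Delta> \<in> rc_borel (power_topology n). M n \<Delta> = M' n \<Delta>"
proof (intro allI impI ballI)
  fix n :: nat and \<Delta> :: "(nat \<Rightarrow> 't) set"
  assume n: "1 \<le> n" and \<Delta>: "\<Delta> \<in> rc_borel (power_topology n)"
  note M = assms(3) and M' = assms(4) and eq = assms(5)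
  obtain A where A: "compact A" "\<Delta> \<in> sets (borel_power A n)"
    using rc_borel_power_in_compact_power[OF \<Delta>] .
  have Ab: "A \<in> sets borel" using A(1) by (simp add: borel_compact)
  have Arc: "A \<in> rc_borel euclidean"
    using A(1) Ab by (simp add: rc_borel_euclidean compact_imp_closed)
  obtain e :: "nat \<Rightarrow> 'g" where e: "\<And>i j. i < Suc n \<Longrightarrow> j < Suc n \<Longrightarrow> inner (e i) (e j) = of_bool (i = j)"
    using orthonormal_system_exists[OF inf_dim] by metis
  have box: "matrix_element M n F1 F2 E = matrix_element M' n F1 F2 E" if E: "E \<in> boxes A n" for F1 F2 E
  proof -
    obtain D where D: "E = PiE {..<n} D" "\<And>i. i < n \<Longrightarrow> D i \<in> sets borel \<and> D i \<subseteq> A"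
      using E by (auto simp: boxes_def)
    define S where "S = closure (\<Union>i<n. D i)"
    have closed: "closed A" using A(1) by (rule compact_imp_closed)
    have compact: "compact (closure X)" if "X \<subseteq> A" for X
      using closure_minimal[OF that closed] A(1) compact_Int_closed[of A "closure X"]
      by (simp add: Int_absorb1)
    have S: "compact S" unfolding S_def using D by (intro compact) auto
    then have "S \<in> rc_borel euclidean"
      by (simp add: rc_borel_euclidean S_def)
    then have pos: "0 \<le> C2 S" "0 \<le> C2' S"
      using M M' by (auto simp: condition_B_def)
    \<comment> \<open>The sup norm of the shift is at most \<open>real n * \<epsilon>\<close>, so
      this weight puts the shift into both domains at once. The constants are taken at the support
      \<open>S\<close>, as \<open>gen_dom\<close> requires, and not at \<open>A\<close>.\<close>
    define \<epsilon> where "\<epsilon> = 1 / (1 + real n * (C2 S + C2' S))"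
    have denom: "1 + real n * (C2 S + C2' S) > 0"
      using pos by (intro add_pos_nonneg) auto
    then have \<epsilon>: "\<epsilon> > 0" by (simp add: \<epsilon>_def)
    have small: "real n * \<epsilon> * C2 S < 1" "real n * \<epsilon> * C2' S < 1"
      using denom pos by (auto simp: \<epsilon>_def field_simps add_pos_nonneg)
    let ?Z = "shift_map \<epsilon> e D n"
    have test: "?Z \<in> test_maps"
    proof (rule shift_map_in_test_maps[OF e \<epsilon>])
      show "D i \<in> rc_borel euclidean" if "i < n" for i
        using D(2)[OF that] compact by (simp add: rc_borel_euclidean)
      show "compact (closure (\<Union>i<n. D i))"
        using S by (simp add: S_def)
    qed
    have supp: "supp ?Z = S"
      unfolding S_def by (rule supp_shift_map[OF e \<epsilon>])
    have le: "sup_norm ?Z \<le> real n * \<epsilon>"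
      by (rule sup_norm_shift_map_le[OF e \<epsilon>])
    have "?Z \<in> gen_dom C2 \<inter> gen_dom C2'"
      using test small mult_right_mono[OF le pos(1)] mult_right_mono[OF le pos(2)]
      by (auto simp: gen_dom_def supp)
    \<comment> \<open>Each side equals the common nonzero factor \<open>\<epsilon> ^ n\<close> times
      the matrix element at the box, so the factor cancels.\<close>
    then have "gen_fun M ?Z (e n) F1 (e 0) F2 = gen_fun M' ?Z (e n) F1 (e 0) F2"
      using eq by simp
    moreover have "gen_fun M ?Z (e n) F1 (e 0) F2 = \<epsilon> ^ n * matrix_element M n F1 F2 E"
      unfolding D(1) using D S by (intro gen_fun_shift_map[OF e \<epsilon> M n]) (auto simp: S_def)
    moreover have "gen_fun M' ?Z (e n) F1 (e 0) F2 = \<epsilon> ^ n * matrix_element M' n F1 F2 E"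
      unfolding D(1) using D S by (intro gen_fun_shift_map[OF e \<epsilon> M' n]) (auto simp: S_def)
    ultimately show ?thesis using \<epsilon> by simp
  qed
  \<comment> \<open>Both sides are signed measures on the Borel sets of the power of
    \<open>A\<close>, and the boxes form a generating pi-system containing the whole power.\<close>
  have "matrix_element M n F1 F2 \<Delta> = matrix_element M' n F1 F2 \<Delta>" for F1 F2
  proof (rule signed_measure_on_eqI)
    show "signed_measure_on (borel_power A n) (matrix_element M n F1 F2)"
      "signed_measure_on (borel_power A n) (matrix_element M' n F1 F2)"
      using M M' Arc n by (auto simp: condition_B_def)
    show "space (borel_power A n) \<in> boxes A n"
      using Ab by (auto simp: boxes_def set_power_def)
    show "Int_stable (boxes A n)" by (rule Int_stable_boxes)
  qed (use box A Ab boxes_subset[of A n] in \<open>simp_all add: sets_borel_power\<close>)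
  then show "M n \<Delta> = M' n \<Delta>"
    unfolding matrix_element_def by (intro blinfun_eqI) (metis vector_eq_rdot)
qed

end
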